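(* Let $T$ be a $6$-tournament. The following are equivalent: (i) $\det(T)=25$; (ii) $\delta_T=5$; (iii) $T$ is switching equivalent to $L_6$; (iv) $T\in\mathcal{D}_5\setminus\mathcal{D}_3$.
   Context: A tournament is a directed graph with exactly one arc between each pair of distinct vertices; $u\rightarrow v$ means the arc goes from $u$ to $v$; a $6$-tournament has 6 vertices. For a tournament $T$ on vertices $v_1,\dots,v_n$, its skew-adjacency matrix is the zero-diagonal matrix $S_T=[s_{ij}]$ with $s_{ij}=-s_{ji}=1$ if $v_i\rightarrow v_j$, and $\det(T):=\det(S_T)$. A subtournament is the tournament induced by a nonempty vertex subset (including $T$ itself). For a positive odd integer $k$, $\mathcal{D}_k$ is the set of tournaments all of whose subtournaments have determinant at most $k^2$. A diamond is a 4-tournament consisting of a directed 3-cycle together with a vertex that either dominates all three cycle vertices or is dominated by all three; $\delta_T$ is the number of 4-vertex subsets of $V(T)$ inducing a diamond. The switch of $T$ with respect to $W\subseteq V(T)$ reverses all arcs between $W$ and $V(T)\setminus W$; switching equivalent means one is a switch of the other. $L_6$ is the tournament on vertices $u_1,\dots,u_6$ with $u_i\rightarrow u_j$ for $1\le i<j\le 5$, $u_6\rightarrow u_1,u_3,u_5$ and $u_2,u_4\rightarrow u_6$; "switching equivalent to $L_6$" means switching equivalent to a tournament isomorphic to $L_6$. *)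

theory Defs
  imports "Graph_Theory.Digraph_Isomorphism" "Jordan_Normal_Form.Determinant"
begin

locale tournament = digraph G for G :: "('a, 'b) pre_digraph" (structure) +
  assumes ex1_arc: "\<lbrakk>u \<in> verts G; v \<in> verts G; u \<noteq> v\<rbrakk>
    \<Longrightarrow> \<exists>!e. e \<in> arcs G \<and> {tail G e, head G e} = {u, v}"

definition skew_adjacency_mat :: "('a, 'b) pre_digraph \<Rightarrow> 'a list \<Rightarrow> int mat" where
  "skew_adjacency_mat G vs = mat (length vs) (length vs) (\<lambda>(i, j).
     if vs ! i \<rightarrow>\<^bsub>G\<^esub> vs ! j then 1 else if vs ! j \<rightarrow>\<^bsub>G\<^esub> vs ! i then -1 else 0)"

text \<open>The choice of the vertex ordering is irrelevant, see \<open>tournament_det_eq\<close> below.\<close>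

definition tournament_det :: "('a, 'b) pre_digraph \<Rightarrow> int" where
  "tournament_det G = det (skew_adjacency_mat G (SOME vs. distinct vs \<and> set vs = verts G))"

definition det_bounded_tournaments :: "nat \<Rightarrow> ('a, 'b) pre_digraph set" (\<open>\<D>\<close>) where
  "\<D> k = {G. tournament G \<and>
     (\<forall>W. W \<subseteq> verts G \<and> W \<noteq> {} \<longrightarrow> tournament_det (G \<restriction> W) \<le> (int k)\<^sup>2)}"

definition diamond :: "('a, 'b) pre_digraph \<Rightarrow> bool" where
  "diamond G \<longleftrightarrow> tournament G \<and> card (verts G) = 4 \<and>
     (\<exists>a b c d. verts G = {a, b, c, d} \<and> a \<rightarrow>\<^bsub>G\<^esub> b \<and> b \<rightarrow>\<^bsub>G\<^esub> c \<and> c \<rightarrow>\<^bsub>G\<^esub> a \<and>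
        (d \<rightarrow>\<^bsub>G\<^esub> a \<and> d \<rightarrow>\<^bsub>G\<^esub> b \<and> d \<rightarrow>\<^bsub>G\<^esub> c \<or> a \<rightarrow>\<^bsub>G\<^esub> d \<and> b \<rightarrow>\<^bsub>G\<^esub> d \<and> c \<rightarrow>\<^bsub>G\<^esub> d))"

definition num_diamonds :: "('a, 'b) pre_digraph \<Rightarrow> nat" (\<open>\<delta>\<close>) where
  "\<delta> G = card {W. W \<subseteq> verts G \<and> card W = 4 \<and> diamond (G \<restriction> W)}"

text \<open>Reversing an arc exchanges its tail and head; the arc itself, as an element of
  \<open>arcs G\<close>, is kept.\<close>

definition switch :: "('a, 'b) pre_digraph \<Rightarrow> 'a set \<Rightarrow> ('a, 'b) pre_digraph" where
  "switch G W = G\<lparr>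
     tail := (\<lambda>e. if (tail G e \<in> W) \<noteq> (head G e \<in> W) then head G e else tail G e),
     head := (\<lambda>e. if (tail G e \<in> W) \<noteq> (head G e \<in> W) then tail G e else head G e)\<rparr>"

definition switching_equivalent :: "('a, 'b) pre_digraph \<Rightarrow> ('a, 'b) pre_digraph \<Rightarrow> bool" where
  "switching_equivalent G H \<longleftrightarrow> (\<exists>W \<subseteq> verts G. H = switch G W)"

definition L\<^sub>6 :: "(nat, nat \<times> nat) pre_digraph" where
  "L\<^sub>6 = \<lparr>verts = {1..6},
          arcs = {(i, j). 1 \<le> i \<and> i < j \<and> j \<le> 5} \<union> {(6, 1), (6, 3), (6, 5), (2, 6), (4, 6)},
          tail = fst, head = snd\<rparr>"

definition switching_equivalent_iso ::
  "('a, 'b) pre_digraph \<Rightarrow> ('c, 'd) pre_digraph \<Rightarrow> bool" where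
  "switching_equivalent_iso G K \<longleftrightarrow> (\<exists>H. switching_equivalent G H \<and> digraph_iso H K)"

lemma det_skew_adjacency_mat_reorder:
  assumes vs: "distinct vs" and ws: "distinct ws" and eq: "set vs = set ws"
  shows "det (skew_adjacency_mat G vs) = det (skew_adjacency_mat G ws)"
proof -
  define n where "n = length ws"
  have len: "length vs = n" using vs ws eq distinct_card n_def by metis
  have bv: "bij_betw ((!) vs) {0..<n} (set ws)"
    using bij_betw_nth[OF vs refl refl] eq len by (simp add: lessThan_atLeast0)
  have bw: "bij_betw ((!) ws) {0..<n} (set ws)"
    using bij_betw_nth[OF ws refl refl] n_def by (simp add: lessThan_atLeast0)
  define q where "q i = (if i < n then the_inv_into {0..<n} ((!) ws) (vs ! i) else i)" for i
  have "bij_betw (the_inv_into {0..<n} ((!) ws) \<circ> (!) vs) {0..<n} {0..<n}"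
    using bv bij_betw_the_inv_into[OF bw] by (rule bij_betw_trans)
  then have "bij_betw q {0..<n} {0..<n}"
    by (rule bij_betw_cong[THEN iffD1, rotated]) (simp add: q_def)
  then have q: "q permutes {0..<n}"
    by (rule bij_imp_permutes) (simp add: q_def)
  have nth: "ws ! q i = vs ! i" if "i < n" for i
  proof -
    have "vs ! i \<in> (!) ws ` {0..<n}"
      using bw that len eq by (metis bij_betw_imp_surj_on nth_mem)
    then show ?thesis
      using that bw by (simp add: q_def f_the_inv_into_f bij_betw_def)
  qed
  have qn: "q i < n" if "i < n" for i
    using permutes_in_image[OF q, of i] that by simp
  let ?A = "skew_adjacency_mat G ws"
  let ?B = "mat n n (\<lambda>(i, j). ?A $$ (q i, j))"
  have A: "?A \<in> carrier_mat n n" by (simp add: skew_adjacency_mat_def n_def)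
  have B: "transpose_mat ?B \<in> carrier_mat n n" by simp
  have "transpose_mat (skew_adjacency_mat G vs) = mat n n (\<lambda>(i, j). transpose_mat ?B $$ (q i, j))"
    using len qn by (auto simp: skew_adjacency_mat_def nth n_def[symmetric])
  then have "det (transpose_mat (skew_adjacency_mat G vs)) = signof q * det (transpose_mat ?B)"
    using det_permute_rows[OF B q] by simp
  moreover have "det (transpose_mat ?B) = det ?B" by (rule det_transpose[of _ n]) simp
  moreover have "det ?B = signof q * det ?A" by (rule det_permute_rows[OF A q])
  moreover have "det (transpose_mat (skew_adjacency_mat G vs)) = det (skew_adjacency_mat G vs)"
    by (rule det_transpose[of _ n]) (simp add: skew_adjacency_mat_def len)
  moreover have "signof q * (signof q * x) = x" for x :: int
    by (simp add: sign_def)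
  ultimately show ?thesis by simp
qed

lemma tournament_det_eq:
  assumes "distinct vs" "set vs = verts G"
  shows "tournament_det G = det (skew_adjacency_mat G vs)"
proof -
  have "distinct (SOME vs. distinct vs \<and> set vs = verts G) \<and>
      set (SOME vs. distinct vs \<and> set vs = verts G) = verts G"
    by (rule someI[of _ vs]) (use assms in simp)
  then show ?thesis
    unfolding tournament_det_def using assms
    by (intro det_skew_adjacency_mat_reorder) auto
qed

lemma tournament_L\<^sub>6: "tournament L\<^sub>6"
proof -
  have sel: "verts L\<^sub>6 = {1..6}" "tail L\<^sub>6 = fst" "head L\<^sub>6 = snd"
    by (simp_all add: L\<^sub>6_def)
  have arcs: "(u, v) \<in> arcs L\<^sub>6 \<longleftrightarrow> 1 \<le> u \<and> u < v \<and> v \<le> 5 \<or>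
      u = 6 \<and> (v = 1 \<or> v = 3 \<or> v = 5) \<or> v = 6 \<and> (u = 2 \<or> u = 4)" for u v
    unfolding L\<^sub>6_def by auto
  have wf: "1 \<le> u \<and> u \<le> 6 \<and> 1 \<le> v \<and> v \<le> 6 \<and> u \<noteq> v" if "(u, v) \<in> arcs L\<^sub>6" for u v
    using that unfolding arcs by presburger
  have "arcs L\<^sub>6 \<subseteq> {1..6} \<times> {1..6}"
    using wf by fastforce
  then have "finite (arcs L\<^sub>6)"
    by (rule finite_subset) simp
  then interpret digraph L\<^sub>6
    using wf by unfold_locales (auto simp: sel arc_to_ends_def)
  show ?thesis
  proof unfold_locales
    fix u v assume "u \<in> verts L\<^sub>6" "v \<in> verts L\<^sub>6" "u \<noteq> v"
    then have "1 \<le> u" "u \<le> 6" "1 \<le> v" "v \<le> 6" "u \<noteq> v"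
      by (simp_all add: sel)
    then have "((u, v) \<in> arcs L\<^sub>6) \<noteq> ((v, u) \<in> arcs L\<^sub>6)"
      unfolding arcs by presburger
    moreover have "{fst e, snd e} = {u, v} \<longleftrightarrow> e = (u, v) \<or> e = (v, u)" for e
      by (cases e) (auto simp: doubleton_eq_iff)
    ultimately show "\<exists>!e. e \<in> arcs L\<^sub>6 \<and> {tail L\<^sub>6 e, head L\<^sub>6 e} = {u, v}"
      unfolding sel by metis
  qed
qed

end

theory Submission
  imports Defs
begin

text \<open>
  Put \<open>s u v = \<plusminus>1\<close> according to the direction of the arc between \<open>u\<close> and \<open>v\<close>. The determinant
  of a tournament of even order is the square of the Pfaffian of \<open>s\<close>, and a 4-subset induces a
  diamond iff its Pfaffian is \<open>\<plusminus>3\<close>. Switching replaces \<open>s u v\<close> by \<open>\<epsilon> u * \<epsilon> v * s u v\<close>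
  with signs \<open>\<epsilon>\<close>, so it changes Pfaffians by a sign only. Hence one may assume that some vertex
  dominates all others; the other five vertices have a Hamiltonian path, which leaves six
  undetermined arcs. Checking the 64 cases gives (i) \<open>\<longleftrightarrow>\<close> (ii) and (i) \<open>\<longrightarrow>\<close> (iii), and
  (iii) \<open>\<longrightarrow>\<close> (i) is the evaluation of the Pfaffian of \<open>L\<^sub>6\<close>. For (iv), subtournaments of
  order at most 5 have determinant at most 9, and the Pfaffian of a 6-tournament is odd, so that
  \<open>9 < det \<le> 25\<close> forces \<open>det = 25\<close>.
\<close>

section \<open>Tournaments and switching\<close>

text \<open>Without parallel arcs an arc is determined by its ends, so a bijection of the vertices
  that respects domination in both directions induces a bijection of the arcs. Isomorphism becomes a
  question about vertices only, whatever the arc types are.\<close>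

lemma digraph_iso_iff_dominates_bij:
  assumes H: "nomulti_digraph H" and K: "nomulti_digraph K"
  shows "digraph_iso H K \<longleftrightarrow> (\<exists>h. bij_betw h (verts H) (verts K) \<and>
    (\<forall>u \<in> verts H. \<forall>v \<in> verts H. u \<rightarrow>\<^bsub>H\<^esub> v \<longleftrightarrow> h u \<rightarrow>\<^bsub>K\<^esub> h v))"
proof
  interpret H: nomulti_digraph H by (rule H)
  assume "digraph_iso H K"
  then obtain f where f: "pre_digraph.digraph_isomorphism H f" and K_eq: "K = app_iso f H"
    by (auto simp: digraph_iso_def)
  have inj: "inj_on (iso_verts f) (verts H)"
    by (rule H.digraph_isomorphism_inj_on_verts[OF f])
  have "u \<rightarrow>\<^bsub>H\<^esub> v \<longleftrightarrow> iso_verts f u \<rightarrow>\<^bsub>K\<^esub> iso_verts f v" if uv: "u \<in> verts H" "v \<in> verts H" for u v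
  proof -
    have "(tail H e, head H e) = (u, v) \<longleftrightarrow>
        (tail K (iso_arcs f e), head K (iso_arcs f e)) = (iso_verts f u, iso_verts f v)"
      if "e \<in> arcs H" for e
      using that uv inj unfolding K_eq
      by (auto simp: H.iso_verts_tail[OF f] H.iso_verts_head[OF f] inj_on_eq_iff)
    then show ?thesis
      unfolding arcs_ends_conv K_eq by (force simp: image_iff)
  qed
  then show "\<exists>h. bij_betw h (verts H) (verts K) \<and>
      (\<forall>u \<in> verts H. \<forall>v \<in> verts H. u \<rightarrow>\<^bsub>H\<^esub> v \<longleftrightarrow> h u \<rightarrow>\<^bsub>K\<^esub> h v)"
    using inj by (intro exI[of _ "iso_verts f"]) (auto simp: K_eq bij_betw_def)
next
  interpret H: nomulti_digraph H by (rule H)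
  interpret K: nomulti_digraph K by (rule K)
  assume "\<exists>h. bij_betw h (verts H) (verts K) \<and>
      (\<forall>u \<in> verts H. \<forall>v \<in> verts H. u \<rightarrow>\<^bsub>H\<^esub> v \<longleftrightarrow> h u \<rightarrow>\<^bsub>K\<^esub> h v)"
  then obtain h where h: "bij_betw h (verts H) (verts K)"
    and dom: "\<And>u v. u \<in> verts H \<Longrightarrow> v \<in> verts H \<Longrightarrow> u \<rightarrow>\<^bsub>H\<^esub> v \<longleftrightarrow> h u \<rightarrow>\<^bsub>K\<^esub> h v"
    by blast
  have "\<exists>e' \<in> arcs K. tail K e' = h (tail H e) \<and> head K e' = h (head H e)" if "e \<in> arcs H" for e
  proof -
    have "h (tail H e) \<rightarrow>\<^bsub>K\<^esub> h (head H e)"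
      using that dom[of "tail H e" "head H e"] by (auto simp: arcs_ends_conv)
    then show ?thesis by (auto simp: arcs_ends_conv)
  qed
  then obtain g where g: "\<And>e. e \<in> arcs H \<Longrightarrow>
      g e \<in> arcs K \<and> tail K (g e) = h (tail H e) \<and> head K (g e) = h (head H e)"
    by metis
  have inj_h: "inj_on h (verts H)" and img_h: "h ` verts H = verts K"
    using h by (auto simp: bij_betw_def)
  have "inj_on g (arcs H)"
  proof (rule inj_onI)
    fix e1 e2 assume e: "e1 \<in> arcs H" "e2 \<in> arcs H" "g e1 = g e2"
    then have "h (tail H e1) = h (tail H e2)" "h (head H e1) = h (head H e2)"
      using g by metis+
    then show "e1 = e2"
      using e inj_h by (intro H.no_multi_arcs) (auto simp: arc_to_ends_def inj_on_eq_iff)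
  qed
  moreover have "g ` arcs H = arcs K"
  proof (intro equalityI subsetI)
    fix e' assume e': "e' \<in> arcs K"
    then have "tail K e' \<in> h ` verts H" "head K e' \<in> h ` verts H"
      by (simp_all add: img_h)
    then obtain u v where uv: "u \<in> verts H" "v \<in> verts H" "tail K e' = h u" "head K e' = h v"
      by blast
    then have "u \<rightarrow>\<^bsub>H\<^esub> v"
      using dom e' by (force simp: arcs_ends_conv)
    then obtain e where e: "e \<in> arcs H" "tail H e = u" "head H e = v"
      by (auto simp: arcs_ends_conv)
    then have "g e = e'"
      using g[OF e(1)] e' uv by (intro K.no_multi_arcs) (auto simp: arc_to_ends_def)
    then show "e' \<in> g ` arcs H" using e(1) by blast
  qed (use g in blast)
  \<comment> \<open>\<open>app_iso\<close> takes its tail and head functions from the isomorphism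
    record, so inserting those of \<open>K\<close> makes the image literally equal to
    \<open>K\<close>.\<close>
  moreover define f where
    "f = \<lparr>iso_verts = h, iso_arcs = g, iso_head = head K, iso_tail = tail K\<rparr>"
  ultimately have "K = app_iso f H" "pre_digraph.digraph_isomorphism H f"
    using g inj_h img_h H.wf_digraph
    by (auto simp: app_iso_def pre_digraph.digraph_isomorphism_def)
  then show "digraph_iso H K"
    unfolding digraph_iso_def by blast
qed

section \<open>Domination under switching and in induced subtournaments\<close>

lemma verts_switch [simp]: "verts (switch G W) = verts G"
  and arcs_switch [simp]: "arcs (switch G W) = arcs G"
  by (simp_all add: switch_def)

lemma tail_switch: "tail (switch G W) e = (if (tail G e \<in> W) \<noteq> (head G e \<in> W) then head G e else tail G e)"
  and head_switch: "head (switch G W) e = (if (tail G e \<in> W) \<noteq> (head G e \<in> W) then tail G e else head G e)"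
  by (simp_all add: switch_def)

lemma dominates_switch:
  "u \<rightarrow>\<^bsub>switch G W\<^esub> v \<longleftrightarrow> (if (u \<in> W) \<noteq> (v \<in> W) then v \<rightarrow>\<^bsub>G\<^esub> u else u \<rightarrow>\<^bsub>G\<^esub> v)"
  by (auto simp: arcs_ends_conv tail_switch head_switch image_iff split: if_splits)

lemma dominates_induce_subgraph:
  "u \<in> W \<Longrightarrow> v \<in> W \<Longrightarrow> u \<rightarrow>\<^bsub>G \<restriction> W\<^esub> v \<longleftrightarrow> u \<rightarrow>\<^bsub>G\<^esub> v"
  by (auto simp: arcs_ends_conv)

context tournament
begin

lemma dominates_iff_not_dominates:
  assumes "u \<in> verts G" "v \<in> verts G" "u \<noteq> v"
  shows "u \<rightarrow>\<^bsub>G\<^esub> v \<longleftrightarrow> \<not> v \<rightarrow>\<^bsub>G\<^esub> u"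
proof -
  obtain e where e: "e \<in> arcs G" "{tail G e, head G e} = {u, v}"
    and uniq: "\<And>e'. e' \<in> arcs G \<Longrightarrow> {tail G e', head G e'} = {u, v} \<Longrightarrow> e' = e"
    using ex1_arc[OF assms] by blast
  \<comment> \<open>Domination in either direction is read off from the unique arc \<open>e\<close>
    between \<open>u\<close> and \<open>v\<close>; the claim is then used for both orders of the
    pair.\<close>
  have "x \<rightarrow>\<^bsub>G\<^esub> y \<longleftrightarrow> tail G e = x \<and> head G e = y" if "{x, y} = {u, v}" for x y
  proof
    assume "x \<rightarrow>\<^bsub>G\<^esub> y"
    then obtain e' where "e' \<in> arcs G" "tail G e' = x" "head G e' = y"
      by (auto simp: arcs_ends_conv)
    then show "tail G e = x \<and> head G e = y"
      using uniq[of e'] that by simp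
  qed (use e(1) in \<open>auto simp: arcs_ends_conv\<close>)
  from this[of u v] this[of v u] show ?thesis
    using e(2) assms(3) by (auto simp: doubleton_eq_iff)
qed

text \<open>Switching keeps the unordered pair of ends of every arc, and the tournament axiom speaks
  of that pair only.\<close>

lemma tournament_switch: "tournament (switch G W)"
proof -
  have ends: "{tail (switch G W) e, head (switch G W) e} = {tail G e, head G e}" for e
    by (auto simp: tail_switch head_switch)
  have eq: "e1 = e2"
    if "e1 \<in> arcs G" "e2 \<in> arcs G" "{tail G e1, head G e1} = {tail G e2, head G e2}" for e1 e2
    using ex1_arc[of "tail G e1" "head G e1"] no_loops[of e1] that by auto
  show ?thesis
  proof unfold_locales
    fix e1 e2 assume "e1 \<in> arcs (switch G W)" "e2 \<in> arcs (switch G W)"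
      "arc_to_ends (switch G W) e1 = arc_to_ends (switch G W) e2"
    then show "e1 = e2"
      using ends[of e1] ends[of e2] by (intro eq) (auto simp: arc_to_ends_def)
  next
    fix u v assume "u \<in> verts (switch G W)" "v \<in> verts (switch G W)" "u \<noteq> v"
    then show "\<exists>!e. e \<in> arcs (switch G W) \<and> {tail (switch G W) e, head (switch G W) e} = {u, v}"
      unfolding ends arcs_switch verts_switch by (rule ex1_arc)
  qed (auto simp: tail_switch head_switch dest: no_loops)
qed

lemma tournament_induce_subgraph:
  assumes "W \<subseteq> verts G"
  shows "tournament (G \<restriction> W)"
proof -
  interpret W: digraph "G \<restriction> W"
    using assms by (intro digraphI_induced induced_induce)
  show ?thesis
  proof unfold_locales
    fix u v assume "u \<in> verts (G \<restriction> W)" "v \<in> verts (G \<restriction> W)" "u \<noteq> v"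
    moreover from this have "{tail G e, head G e} = {u, v} \<Longrightarrow> tail G e \<in> W \<and> head G e \<in> W" for e
      by (auto simp: doubleton_eq_iff)
    ultimately show "\<exists>!e. e \<in> arcs (G \<restriction> W) \<and> {tail (G \<restriction> W) e, head (G \<restriction> W) e} = {u, v}"
      using ex1_arc[of u v] assms by (simp add: subset_iff) metis
  qed
qed

end

section \<open>Signs of arcs\<close>

text \<open>The entries of the skew-adjacency matrix, indexed by vertices instead of positions in an
  ordering.\<close>

definition arc_sign :: "('a, 'b) pre_digraph \<Rightarrow> 'a \<Rightarrow> 'a \<Rightarrow> int" where
  "arc_sign G u v = (if u \<rightarrow>\<^bsub>G\<^esub> v then 1 else if v \<rightarrow>\<^bsub>G\<^esub> u then -1 else 0)"

text \<open>Abstracts from digraphs so that sign functions can be switched directly, without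
  building a switched digraph. Skewness at \<open>u = v\<close> forces a zero diagonal.\<close>

definition skew_sign_on :: "'a set \<Rightarrow> ('a \<Rightarrow> 'a \<Rightarrow> int) \<Rightarrow> bool" where
  "skew_sign_on V s \<longleftrightarrow> (\<forall>u \<in> V. \<forall>v \<in> V. s v u = - s u v \<and> (u \<noteq> v \<longrightarrow> s u v = 1 \<or> s u v = -1))"

lemma skew_sign_on_swap: "skew_sign_on V s \<Longrightarrow> u \<in> V \<Longrightarrow> v \<in> V \<Longrightarrow> s v u = - s u v"
  unfolding skew_sign_on_def by blast

lemma skew_sign_on_cases:
  "skew_sign_on V s \<Longrightarrow> u \<in> V \<Longrightarrow> v \<in> V \<Longrightarrow> u \<noteq> v \<Longrightarrow> s u v = 1 \<or> s u v = -1"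
  unfolding skew_sign_on_def by blast

lemma skew_sign_on_diag: "skew_sign_on V s \<Longrightarrow> u \<in> V \<Longrightarrow> s u u = 0"
  using skew_sign_on_swap[of V s u u] by simp

lemma (in tournament) skew_sign_on_arc_sign: "skew_sign_on (verts G) (arc_sign G)"
proof -
  have "arc_sign G v u = - arc_sign G u v \<and> (u \<noteq> v \<longrightarrow> arc_sign G u v = 1 \<or> arc_sign G u v = -1)"
    if "u \<in> verts G" "v \<in> verts G" for u v
    using dominates_iff_not_dominates[OF that] adj_not_same[of u]
    by (cases "u = v") (auto simp: arc_sign_def)
  then show ?thesis unfolding skew_sign_on_def by blast
qed

text \<open>On matrices, switching is conjugation by the diagonal matrix with entry -1 on
  \<open>W\<close> and 1 elsewhere.\<close>

lemma (in tournament) arc_sign_switch: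
  assumes "u \<in> verts G" "v \<in> verts G"
  shows "arc_sign (switch G W) u v =
    (if u \<in> W then -1 else 1) * (if v \<in> W then -1 else 1) * arc_sign G u v"
  using assms dominates_iff_not_dominates[of u v] adj_not_same
  by (cases "u = v") (auto simp: arc_sign_def dominates_switch)

section \<open>Hamiltonian paths\<close>

text \<open>\<open>x\<close> goes in front of the first entry \<open>v\<close> with
  \<open>R x v\<close>, or to the end if there is none. The clause about \<open>hd ws\<close>
  strengthens the induction: it guarantees that a skipped entry is still related to the head of the
  list that follows it.\<close>

lemma ex_Hamiltonian_list_insert:
  assumes "successively R vs" "\<forall>v \<in> set vs. R x v \<or> R v x"
  shows "\<exists>ws. mset ws = mset (x # vs) \<and> successively R ws \<and>
    (vs \<noteq> [] \<longrightarrow> hd ws = x \<or> hd ws = hd vs)"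
  using assms
proof (induction vs)
  case Nil
  then show ?case by (intro exI[of _ "[x]"]) simp
next
  case (Cons v vs)
  show ?case
  proof (cases "R x v")
    case True
    then show ?thesis using Cons.prems by (intro exI[of _ "x # v # vs"]) simp
  next
    case False
    then have "R v x" using Cons.prems by auto
    obtain ws where ws: "mset ws = mset (x # vs)" "successively R ws"
      "vs \<noteq> [] \<longrightarrow> hd ws = x \<or> hd ws = hd vs"
      using Cons by (auto simp: successively_Cons)
    moreover have "R v (hd ws)"
    proof (cases "vs = []")
      case True
      then show ?thesis using ws(1) \<open>R v x\<close> by simp
    next
      case False
      then show ?thesis using ws(3) \<open>R v x\<close> Cons.prems(1) by (auto simp: successively_Cons)
    qed
    ultimately show ?thesis
      by (intro exI[of _ "v # ws"]) (auto simp: successively_Cons)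
  qed
qed

text \<open>Redei's theorem on Hamiltonian paths, by inserting the vertices one at a time.\<close>

lemma ex_Hamiltonian_list:
  assumes "finite V" "\<And>u v. u \<in> V \<Longrightarrow> v \<in> V \<Longrightarrow> u \<noteq> v \<Longrightarrow> R u v \<or> R v u"
  shows "\<exists>vs. distinct vs \<and> set vs = V \<and> successively R vs"
  using assms
proof (induction V rule: finite_induct)
  case empty
  then show ?case by simp
next
  case (insert x V)
  then obtain vs where vs: "distinct vs" "set vs = V" "successively R vs"
    by auto
  have "\<forall>v \<in> set vs. R x v \<or> R v x"
  proof
    fix v assume "v \<in> set vs"
    then show "R x v \<or> R v x"
      using insert.prems[of x v] insert.hyps(2) vs(2) by auto
  qed
  from ex_Hamiltonian_list_insert[OF vs(3) this]
  obtain ws where ws: "mset ws = mset (x # vs)" "successively R ws"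
    by (elim exE conjE)
  then show ?case
    using vs insert.hyps(2) mset_eq_imp_distinct_iff[OF ws(1)] mset_eq_setD[OF ws(1)]
    by (intro exI[of _ ws]) simp
qed

section \<open>Pfaffians\<close>

text \<open>Laplace expansion along the first row. Column \<open>j\<close> is deleted by
  \<open>take\<close> and \<open>drop\<close> in the remaining rows, so the simplifier turns an
  explicit matrix into explicit minors.\<close>

lemma det_mat_of_rows_list_Cons:
  fixes r :: "'a :: comm_ring_1 list"
  assumes "length r = Suc n" "length rs = n" "\<forall>r \<in> set rs. length r = Suc n"
  shows "det (mat_of_rows_list (Suc n) (r # rs)) =
    (\<Sum>j<Suc n. r ! j * ((-1) ^ j * det (mat_of_rows_list n (map (\<lambda>r. take j r @ drop (Suc j) r) rs))))"
proof -
  let ?A = "mat_of_rows_list (Suc n) (r # rs)"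
  have A: "?A \<in> carrier_mat (Suc n) (Suc n)"
    using assms by (simp add: mat_of_rows_list_def)
  have "mat_delete ?A 0 j = mat_of_rows_list n (map (\<lambda>r. take j r @ drop (Suc j) r) rs)"
    if "j < Suc n" for j
    unfolding mat_delete_def mat_of_rows_list_def
    using that assms by (intro eq_matI) (auto simp: nth_append)
  then have "cofactor ?A 0 j = (-1) ^ j * det (mat_of_rows_list n (map (\<lambda>r. take j r @ drop (Suc j) r) rs))"
    if "j < Suc n" for j
    using that by (simp add: cofactor_def)
  moreover have "?A $$ (0, j) = r ! j" if "j < Suc n" for j
    using that by (simp add: mat_of_rows_list_def)
  ultimately show ?thesis
    using laplace_expansion_row[OF A, of 0] by simp
qed

lemma det_mat_of_rows_list_Nil [simp]: "det (mat_of_rows_list 0 []) = 1"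
  by (simp add: mat_of_rows_list_def)

lemma det_2: "det (mat_of_rows_list 2 [[a, b], [c, d]]) = a * d - b * (c :: 'a :: comm_ring_1)"
  by (simp add: det_mat_of_rows_list_Cons eval_nat_numeral)

text \<open>Here and in the next orders only one level is expanded and the minors stay determinants.
  Fixing \<open>n\<close> in the expansion rule prevents it from rewriting the minors as
  well.\<close>

lemma det_3:
  fixes x00 :: "'a :: comm_ring_1"
  shows "det (mat_of_rows_list 3
      [[x00, x01, x02], [x10, x11, x12], [x20, x21, x22]]) =
    x00 * det (mat_of_rows_list 2
      [[x11, x12], [x21, x22]])
    - x01 * det (mat_of_rows_list 2
      [[x10, x12], [x20, x22]])
    + x02 * det (mat_of_rows_list 2
      [[x10, x11], [x20, x21]])"
  by (simp add: det_mat_of_rows_list_Cons[where n = "Suc (Suc 0)"] eval_nat_numeral)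

lemma det_4:
  fixes x00 :: "'a :: comm_ring_1"
  shows "det (mat_of_rows_list 4
      [[x00, x01, x02, x03], [x10, x11, x12, x13], [x20, x21, x22, x23], [x30, x31, x32, x33]]) =
    x00 * det (mat_of_rows_list 3
      [[x11, x12, x13], [x21, x22, x23], [x31, x32, x33]])
    - x01 * det (mat_of_rows_list 3
      [[x10, x12, x13], [x20, x22, x23], [x30, x32, x33]])
    + x02 * det (mat_of_rows_list 3
      [[x10, x11, x13], [x20, x21, x23], [x30, x31, x33]])
    - x03 * det (mat_of_rows_list 3
      [[x10, x11, x12], [x20, x21, x22], [x30, x31, x32]])"
  by (simp add: det_mat_of_rows_list_Cons[where n = "Suc (Suc (Suc 0))"] eval_nat_numeral)

lemma det_5:
  fixes x00 :: "'a :: comm_ring_1"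
  shows "det (mat_of_rows_list 5
      [[x00, x01, x02, x03, x04], [x10, x11, x12, x13, x14], [x20, x21, x22, x23, x24],
      [x30, x31, x32, x33, x34], [x40, x41, x42, x43, x44]]) =
    x00 * det (mat_of_rows_list 4
      [[x11, x12, x13, x14], [x21, x22, x23, x24], [x31, x32, x33, x34], [x41, x42, x43, x44]])
    - x01 * det (mat_of_rows_list 4
      [[x10, x12, x13, x14], [x20, x22, x23, x24], [x30, x32, x33, x34], [x40, x42, x43, x44]])
    + x02 * det (mat_of_rows_list 4
      [[x10, x11, x13, x14], [x20, x21, x23, x24], [x30, x31, x33, x34], [x40, x41, x43, x44]])
    - x03 * det (mat_of_rows_list 4
      [[x10, x11, x12, x14], [x20, x21, x22, x24], [x30, x31, x32, x34], [x40, x41, x42, x44]])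
    + x04 * det (mat_of_rows_list 4
      [[x10, x11, x12, x13], [x20, x21, x22, x23], [x30, x31, x32, x33], [x40, x41, x42, x43]])"
  by (simp add: det_mat_of_rows_list_Cons[where n = "Suc (Suc (Suc (Suc 0)))"] eval_nat_numeral)

lemma det_6:
  fixes x00 :: "'a :: comm_ring_1"
  shows "det (mat_of_rows_list 6
      [[x00, x01, x02, x03, x04, x05], [x10, x11, x12, x13, x14, x15],
      [x20, x21, x22, x23, x24, x25], [x30, x31, x32, x33, x34, x35],
      [x40, x41, x42, x43, x44, x45], [x50, x51, x52, x53, x54, x55]]) =
    x00 * det (mat_of_rows_list 5
      [[x11, x12, x13, x14, x15], [x21, x22, x23, x24, x25], [x31, x32, x33, x34, x35],
      [x41, x42, x43, x44, x45], [x51, x52, x53, x54, x55]])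
    - x01 * det (mat_of_rows_list 5
      [[x10, x12, x13, x14, x15], [x20, x22, x23, x24, x25], [x30, x32, x33, x34, x35],
      [x40, x42, x43, x44, x45], [x50, x52, x53, x54, x55]])
    + x02 * det (mat_of_rows_list 5
      [[x10, x11, x13, x14, x15], [x20, x21, x23, x24, x25], [x30, x31, x33, x34, x35],
      [x40, x41, x43, x44, x45], [x50, x51, x53, x54, x55]])
    - x03 * det (mat_of_rows_list 5
      [[x10, x11, x12, x14, x15], [x20, x21, x22, x24, x25], [x30, x31, x32, x34, x35],
      [x40, x41, x42, x44, x45], [x50, x51, x52, x54, x55]])
    + x04 * det (mat_of_rows_list 5
      [[x10, x11, x12, x13, x15], [x20, x21, x22, x23, x25], [x30, x31, x32, x33, x35],
      [x40, x41, x42, x43, x45], [x50, x51, x52, x53, x55]])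
    - x05 * det (mat_of_rows_list 5
      [[x10, x11, x12, x13, x14], [x20, x21, x22, x23, x24], [x30, x31, x32, x33, x34],
      [x40, x41, x42, x43, x44], [x50, x51, x52, x53, x54]])"
  by (simp add: det_mat_of_rows_list_Cons[where n = "Suc (Suc (Suc (Suc (Suc 0))))"] eval_nat_numeral)

text \<open>Cayley's identity, the determinant as the square of the Pfaffian, checked as a
  polynomial identity.\<close>

lemma det_skew_4:
  fixes a :: "int"
  shows "det (mat_of_rows_list 4 [[0, a, b, c], [-a, 0, d, e], [-b, -d, 0, f], [-c, -e, -f, 0]]) =
    (a * f - b * e + c * d)\<^sup>2"
  by (simp add: det_4 det_3 det_2 algebra_simps power2_eq_square)

text \<open>Cayley's identity in order 6, with the Pfaffian grouped by its expansion along the first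
  row. The letter \<open>o\<close> is skipped because it denotes composition.\<close>

lemma det_skew_6:
  fixes a :: "int"
  shows "det (mat_of_rows_list 6 [[0, a, b, c, d, e], [-a, 0, f, g, h, i], [-b, -f, 0, j, k, l],
      [-c, -g, -j, 0, m, n], [-d, -h, -k, -m, 0, p], [-e, -i, -l, -n, -p, 0]]) =
    (a * (j * p - k * n + l * m) - b * (g * p - h * n + i * m) + c * (f * p - h * l + i * k)
      - d * (f * n - g * l + i * j) + e * (f * m - g * k + h * j))\<^sup>2"
  unfolding det_6 det_5 det_4 det_3 det_2
  by (simp add: algebra_simps power2_eq_square)

section \<open>Pfaffians, subtournament determinants and diamonds\<close>

text \<open>The Pfaffian on four vertices: one signed product for each of the three perfect
  matchings.\<close>

definition pf4 :: "('a \<Rightarrow> 'a \<Rightarrow> int) \<Rightarrow> 'a \<Rightarrow> 'a \<Rightarrow> 'a \<Rightarrow> 'a \<Rightarrow> int" where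
  "pf4 s a b c d = s a b * s c d - s a c * s b d + s a d * s b c"

text \<open>The Pfaffian on six vertices, expanded along the partner of \<open>a\<close> in a
  perfect matching.\<close>

definition pf6 :: "('a \<Rightarrow> 'a \<Rightarrow> int) \<Rightarrow> 'a \<Rightarrow> 'a \<Rightarrow> 'a \<Rightarrow> 'a \<Rightarrow> 'a \<Rightarrow> 'a \<Rightarrow> int" where
  "pf6 s a b c d e f = s a b * pf4 s c d e f - s a c * pf4 s b d e f + s a d * pf4 s b c e f
    - s a e * pf4 s b c d f + s a f * pf4 s b c d e"

lemma tournament_det_induce_subgraph:
  assumes "distinct vs"
  shows "tournament_det (G \<restriction> set vs) =
    det (mat_of_rows_list (length vs) (map (\<lambda>u. map (arc_sign G u) vs) vs))"
proof -
  have "skew_adjacency_mat (G \<restriction> set vs) vs =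
      mat_of_rows_list (length vs) (map (\<lambda>u. map (arc_sign G u) vs) vs)"
    by (rule eq_matI)
      (auto simp: skew_adjacency_mat_def mat_of_rows_list_def arc_sign_def dominates_induce_subgraph)
  then show ?thesis
    using assms by (simp add: tournament_det_eq[of vs])
qed

context tournament
begin

lemma induce_subgraph_verts_self: "G \<restriction> verts G = G"
  by (rule pre_digraph.equality) auto

lemma tournament_det_induce_subgraph_2:
  assumes "distinct [a, b]" "{a, b} \<subseteq> verts G"
  shows "tournament_det (G \<restriction> {a, b}) = 1"
proof -
  note s = skew_sign_on_arc_sign
  have "arc_sign G a b = 1 \<or> arc_sign G a b = -1" "arc_sign G b a = - arc_sign G a b"
    using assms skew_sign_on_cases[OF s, of a b] skew_sign_on_swap[OF s, of a b] by auto
  then show ?thesis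
    using tournament_det_induce_subgraph[OF assms(1), of G] assms(2)
    by (auto simp: numeral_2_eq_2[symmetric] det_2 skew_sign_on_diag[OF s])
qed

lemma tournament_det_induce_subgraph_4:
  assumes "distinct [a, b, c, d]" "{a, b, c, d} \<subseteq> verts G"
  shows "tournament_det (G \<restriction> {a, b, c, d}) = (pf4 (arc_sign G) a b c d)\<^sup>2"
proof -
  define s where "s = arc_sign G"
  have "s b a = - s a b" "s c a = - s a c" "s c b = - s b c" "s d a = - s a d" "s d b = - s b d"
    "s d c = - s c d" "s a a = 0" "s b b = 0" "s c c = 0" "s d d = 0"
    using assms(2) unfolding s_def
    by (auto intro!: skew_sign_on_swap[OF skew_sign_on_arc_sign] skew_sign_on_diag[OF skew_sign_on_arc_sign])
  then show ?thesis
    using tournament_det_induce_subgraph[OF assms(1), of G]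
      det_skew_4[of "s a b" "s a c" "s a d" "s b c" "s b d" "s c d"]
    by (simp add: pf4_def s_def[symmetric] eval_nat_numeral)
qed

lemma tournament_det_6:
  assumes "distinct [a, b, c, d, e, f]" "verts G = {a, b, c, d, e, f}"
  shows "tournament_det G = (pf6 (arc_sign G) a b c d e f)\<^sup>2"
proof -
  define s where "s = arc_sign G"
  have "s b a = - s a b" "s c a = - s a c" "s c b = - s b c" "s d a = - s a d" "s d b = - s b d"
    "s d c = - s c d" "s e a = - s a e" "s e b = - s b e" "s e c = - s c e" "s e d = - s d e"
    "s f a = - s a f" "s f b = - s b f" "s f c = - s c f" "s f d = - s d f" "s f e = - s e f"
    "s a a = 0" "s b b = 0" "s c c = 0" "s d d = 0" "s e e = 0" "s f f = 0"
    using assms(2) unfolding s_def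
    by (auto intro!: skew_sign_on_swap[OF skew_sign_on_arc_sign] skew_sign_on_diag[OF skew_sign_on_arc_sign])
  then show ?thesis
    using tournament_det_induce_subgraph[OF assms(1), of G] induce_subgraph_verts_self assms(2)
      det_skew_6[of "s a b" "s a c" "s a d" "s a e" "s a f" "s b c" "s b d" "s b e" "s b f"
        "s c d" "s c e" "s c f" "s d e" "s d f" "s e f"]
    by (simp add: pf6_def pf4_def s_def[symmetric] eval_nat_numeral)
qed

text \<open>A skew matrix of odd order \<open>n\<close> satisfies
  \<open>det A = (-1) ^ n * det A = - det A\<close>.\<close>

lemma tournament_det_induce_subgraph_odd:
  assumes "distinct vs" "set vs \<subseteq> verts G" "odd (length vs)"
  shows "tournament_det (G \<restriction> set vs) = 0"
proof -
  define n where "n = length vs"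
  define A where "A = mat_of_rows_list n (map (\<lambda>u. map (arc_sign G u) vs) vs)"
  have A: "A \<in> carrier_mat n n"
    by (simp add: A_def n_def mat_of_rows_list_def)
  have "transpose_mat A = (-1) \<cdot>\<^sub>m A"
    using assms(2) unfolding A_def n_def mat_of_rows_list_def
    by (intro eq_matI) (auto intro!: skew_sign_on_swap[OF skew_sign_on_arc_sign])
  then have "det A = (-1) ^ n * det A"
    using det_transpose[OF A] A by simp
  then show ?thesis
    using assms tournament_det_induce_subgraph[OF assms(1), of G] by (simp add: A_def n_def)
qed

text \<open>The Pfaffian is a sum of three terms, each 1 or -1, so its square is 9 exactly when all
  three agree. This agreement characterises a 3-cycle together with a vertex that dominates it or is
  dominated by it.\<close>

lemma diamond_induce_subgraph_iff:
  assumes "distinct [a, b, c, d]" "{a, b, c, d} \<subseteq> verts G"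
  shows "diamond (G \<restriction> {a, b, c, d}) \<longleftrightarrow> (pf4 (arc_sign G) a b c d)\<^sup>2 = 9"
proof
  define s where "s = arc_sign G"
  have s: "skew_sign_on (verts G) s"
    using skew_sign_on_arc_sign by (simp add: s_def)
  have dom: "u \<rightarrow>\<^bsub>G\<^esub> v \<longleftrightarrow> s u v = 1" for u v
    by (simp add: s_def arc_sign_def)
  assume "diamond (G \<restriction> {a, b, c, d})"
  then obtain p q r t where "verts (G \<restriction> {a, b, c, d}) = {p, q, r, t}"
    and D: "p \<rightarrow>\<^bsub>G \<restriction> {a, b, c, d}\<^esub> q" "q \<rightarrow>\<^bsub>G \<restriction> {a, b, c, d}\<^esub> r" "r \<rightarrow>\<^bsub>G \<restriction> {a, b, c, d}\<^esub> p"
      "t \<rightarrow>\<^bsub>G \<restriction> {a, b, c, d}\<^esub> p \<and> t \<rightarrow>\<^bsub>G \<restriction> {a, b, c, d}\<^esub> q \<and> t \<rightarrow>\<^bsub>G \<restriction> {a, b, c, d}\<^esub> r \<or>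
        p \<rightarrow>\<^bsub>G \<restriction> {a, b, c, d}\<^esub> t \<and> q \<rightarrow>\<^bsub>G \<restriction> {a, b, c, d}\<^esub> t \<and> r \<rightarrow>\<^bsub>G \<restriction> {a, b, c, d}\<^esub> t"
    unfolding diamond_def by (elim conjE exE) (rule that)
  then have W: "{a, b, c, d} = {p, q, r, t}"
    by simp
  have *: "s p q = 1 \<and> s q r = 1 \<and> s r p = 1 \<and>
      (s t p = 1 \<and> s t q = 1 \<and> s t r = 1 \<or> s p t = 1 \<and> s q t = 1 \<and> s r t = 1)"
    using D unfolding dom[symmetric]
    by (auto dest: dominates_induce_subgraphD)
  have "card {p, q, r, t} = 4"
    using assms(1) unfolding W[symmetric] by simp
  then have dist: "distinct [p, q, r, t]"
    by (intro card_distinct) simp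
  have V: "p \<in> verts G" "q \<in> verts G" "r \<in> verts G" "t \<in> verts G"
    using assms(2) unfolding W by auto
  \<comment> \<open>The dominating and the dominated apex are treated together: the common sign
    \<open>s p t\<close> tells them apart, and the Pfaffian in this labelling is three times
    it.\<close>
  have "s p r = - 1" "s r t = s p t" "s q t = s p t" "s p t = 1 \<or> s p t = -1"
    using * skew_sign_on_swap[OF s V(1,3)] skew_sign_on_swap[OF s V(3,4)]
      skew_sign_on_swap[OF s V(2,4)] skew_sign_on_swap[OF s V(1,4)]
    by auto
  \<comment> \<open>The squares for the labellings \<open>p q r t\<close> and \<open>a b c d\<close>
    agree since both are the determinant of the same subtournament; no permutation sign has to be
    computed.\<close>
  moreover have "tournament_det (G \<restriction> {a, b, c, d}) = (pf4 s p q r t)\<^sup>2"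
    unfolding W s_def using dist V by (intro tournament_det_induce_subgraph_4) auto
  ultimately show "(pf4 (arc_sign G) a b c d)\<^sup>2 = 9"
    using tournament_det_induce_subgraph_4[OF assms] * by (auto simp: pf4_def)
next
  define s where "s = arc_sign G"
  have s: "skew_sign_on (verts G) s"
    using skew_sign_on_arc_sign by (simp add: s_def)
  define D where "D p q r t \<longleftrightarrow> s p q = 1 \<and> s q r = 1 \<and> s r p = 1 \<and>
    (s t p = 1 \<and> s t q = 1 \<and> s t r = 1 \<or> s p t = 1 \<and> s q t = 1 \<and> s r t = 1)" for p q r t
  have diamondI: "diamond (G \<restriction> {a, b, c, d})" if "D p q r t" "{p, q, r, t} = {a, b, c, d}" for p q r t
    unfolding diamond_def
  proof (intro conjI exI)
    show "tournament (G \<restriction> {a, b, c, d})" "card (verts (G \<restriction> {a, b, c, d})) = 4"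
      using tournament_induce_subgraph assms by auto
    show "verts (G \<restriction> {a, b, c, d}) = {p, q, r, t}"
      using that by simp
    have dom: "u \<rightarrow>\<^bsub>G \<restriction> {a, b, c, d}\<^esub> v \<longleftrightarrow> s u v = 1" if "u \<in> {p, q, r, t}" "v \<in> {p, q, r, t}" for u v
      using that dominates_induce_subgraph[of u "{a, b, c, d}" v G]
      unfolding \<open>{p, q, r, t} = {a, b, c, d}\<close> by (simp add: s_def arc_sign_def)
    show "p \<rightarrow>\<^bsub>G \<restriction> {a, b, c, d}\<^esub> q" "q \<rightarrow>\<^bsub>G \<restriction> {a, b, c, d}\<^esub> r" "r \<rightarrow>\<^bsub>G \<restriction> {a, b, c, d}\<^esub> p"
      "t \<rightarrow>\<^bsub>G \<restriction> {a, b, c, d}\<^esub> p \<and> t \<rightarrow>\<^bsub>G \<restriction> {a, b, c, d}\<^esub> q \<and> t \<rightarrow>\<^bsub>G \<restriction> {a, b, c, d}\<^esub> r \<or>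
        p \<rightarrow>\<^bsub>G \<restriction> {a, b, c, d}\<^esub> t \<and> q \<rightarrow>\<^bsub>G \<restriction> {a, b, c, d}\<^esub> t \<and> r \<rightarrow>\<^bsub>G \<restriction> {a, b, c, d}\<^esub> t"
      using that(1) by (simp_all add: dom D_def)
  qed
  assume "(pf4 (arc_sign G) a b c d)\<^sup>2 = 9"
  then have pf: "(pf4 s a b c d)\<^sup>2 = 9" by (simp add: s_def)
  have swap: "s b a = - s a b" "s c a = - s a c" "s c b = - s b c" "s d a = - s a d"
    "s d b = - s b d" "s d c = - s c d"
    using assms(2) by (auto intro!: skew_sign_on_swap[OF s])
  have "s a b = 1 \<or> s a b = -1" "s a c = 1 \<or> s a c = -1" "s a d = 1 \<or> s a d = -1"
    "s b c = 1 \<or> s b c = -1" "s b d = 1 \<or> s b d = -1" "s c d = 1 \<or> s c d = -1"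
    using assms by - (rule skew_sign_on_cases[OF s]; simp)+
  \<comment> \<open>Four choices of the apex, the last argument of \<open>D\<close>, and two
    orientations of the 3-cycle on the other vertices.\<close>
  then have "D b c d a \<or> D b d c a \<or> D a c d b \<or> D a d c b \<or> D a b d c \<or> D a d b c \<or> D a b c d \<or> D a c b d"
    using pf unfolding D_def swap pf4_def by (elim disjE) simp_all
  then show "diamond (G \<restriction> {a, b, c, d})"
    by (elim disjE) (erule diamondI, blast)+
qed

end

section \<open>Counting diamonds along a vertex list\<close>

text \<open>Summing over sublists instead of subsets makes the count unfold by simplification on an
  explicit list. Each 4-subset is tested once, in the order inherited from
  \<open>vs\<close>.\<close>

definition diamond_count :: "('a \<Rightarrow> 'a \<Rightarrow> int) \<Rightarrow> 'a list \<Rightarrow> nat" where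
  "diamond_count s vs =
    (\<Sum>xs \<leftarrow> subseqs vs. of_bool (case xs of [a, b, c, d] \<Rightarrow> (pf4 s a b c d)\<^sup>2 = 9 | _ \<Rightarrow> False))"

lemma length_filter_eq_sum_list: "length (filter P xs) = (\<Sum>x \<leftarrow> xs. of_bool (P x))"
  by (induction xs) auto

text \<open>For a distinct list, \<open>set\<close> maps the sublists bijectively onto the subsets
  of the vertex set, and on sublists of length four the diamond condition is the Pfaffian
  condition.\<close>

lemma (in tournament) num_diamonds_eq_diamond_count:
  assumes vs: "distinct vs" "set vs = verts G"
  shows "\<delta> G = diamond_count (arc_sign G) vs"
proof -
  let ?P = "\<lambda>W. card W = 4 \<and> diamond (G \<restriction> W)"
  let ?Q = "\<lambda>xs. case xs of [a, b, c, d] \<Rightarrow> (pf4 (arc_sign G) a b c d)\<^sup>2 = 9 | _ \<Rightarrow> False"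
  have iff: "?P (set xs) \<longleftrightarrow> ?Q xs" if "xs \<in> set (subseqs vs)" for xs
  proof -
    have xs: "distinct xs" "set xs \<subseteq> verts G"
      using subseqs_distinctD[OF that vs(1)] that subseqs_powset[of vs] vs(2) by blast+
    show ?thesis
    proof (cases "length xs = 4")
      case True
      then obtain a b c d where "xs = [a, b, c, d]"
        by (auto simp: numeral_eq_Suc length_Suc_conv)
      then show ?thesis
        using xs diamond_induce_subgraph_iff[of a b c d] by simp
    next
      case False
      then show ?thesis
        using distinct_card[OF xs(1)] by (auto split: list.splits)
    qed
  qed
  have "{W. W \<subseteq> verts G \<and> card W = 4 \<and> diamond (G \<restriction> W)} = Set.filter ?P (set (map set (subseqs vs)))"
    using subseqs_powset[of vs] vs(2) by auto
  then have "\<delta> G = card (set (filter ?P (map set (subseqs vs))))"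
    by (simp add: num_diamonds_def)
  also have "\<dots> = length (filter ?P (map set (subseqs vs)))"
    using distinct_set_subseqs[OF vs(1)] by (intro distinct_card distinct_filter)
  also have "\<dots> = length (filter (\<lambda>xs. ?P (set xs)) (subseqs vs))"
    by (simp add: filter_map o_def)
  also have "filter (\<lambda>xs. ?P (set xs)) (subseqs vs) = filter ?Q (subseqs vs)"
    using iff by (intro filter_cong refl)
  finally show ?thesis
    by (simp only: diamond_count_def length_filter_eq_sum_list)
qed

section \<open>Switching invariance and the normal form\<close>

text \<open>Every perfect matching covers each vertex exactly once, so each term acquires the same
  product of signs.\<close>

lemma pf4_switch:
  fixes \<epsilon> :: "'a \<Rightarrow> int"
  shows "pf4 (\<lambda>u v. \<epsilon> u * \<epsilon> v * s u v) a b c d = \<epsilon> a * \<epsilon> b * \<epsilon> c * \<epsilon> d * pf4 s a b c d"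
  by (simp add: pf4_def algebra_simps)

lemma pf6_switch:
  fixes \<epsilon> :: "'a \<Rightarrow> int"
  shows "pf6 (\<lambda>u v. \<epsilon> u * \<epsilon> v * s u v) a b c d e f =
    \<epsilon> a * \<epsilon> b * \<epsilon> c * \<epsilon> d * \<epsilon> e * \<epsilon> f * pf6 s a b c d e f"
  unfolding pf6_def pf4_switch by (simp add: algebra_simps)

lemma diamond_count_switch:
  fixes \<epsilon> :: "'a \<Rightarrow> int"
  assumes "\<And>u. (\<epsilon> u)\<^sup>2 = 1"
  shows "diamond_count (\<lambda>u v. \<epsilon> u * \<epsilon> v * s u v) vs = diamond_count s vs"
proof -
  have "(pf4 (\<lambda>u v. \<epsilon> u * \<epsilon> v * s u v) a b c d)\<^sup>2 = (pf4 s a b c d)\<^sup>2" for a b c d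
    by (simp add: pf4_switch[of \<epsilon>] power_mult_distrib assms)
  then show ?thesis
    unfolding diamond_count_def by presburger
qed

lemma skew_sign_on_switch:
  fixes \<epsilon> :: "'a \<Rightarrow> int"
  assumes "skew_sign_on V s" "\<And>u. u \<in> V \<Longrightarrow> \<epsilon> u = 1 \<or> \<epsilon> u = -1"
  shows "skew_sign_on V (\<lambda>u v. \<epsilon> u * \<epsilon> v * s u v)"
  unfolding skew_sign_on_def
proof (intro ballI conjI impI)
  fix u v assume uv: "u \<in> V" "v \<in> V"
  show "\<epsilon> v * \<epsilon> u * s v u = - (\<epsilon> u * \<epsilon> v * s u v)"
    using skew_sign_on_swap[OF assms(1) uv] by simp
  assume "u \<noteq> v"
  then show "\<epsilon> u * \<epsilon> v * s u v = 1 \<or> \<epsilon> u * \<epsilon> v * s u v = -1"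
    using skew_sign_on_cases[OF assms(1) uv] assms(2)[OF uv(1)] assms(2)[OF uv(2)] by auto
qed

text \<open>
  The switching invariant form of \<open>L\<^sub>6\<close>: with \<open>\<epsilon> x\<^sub>i = (-1)\<^sup>i s z x\<^sub>i\<close> and
  \<open>\<epsilon> z = 1\<close>, switching by \<open>\<epsilon>\<close> makes \<open>xs\<close> transitive and lets \<open>z\<close> dominate exactly
  the entries of \<open>xs\<close> at even positions, counted from 0.
\<close>

definition alternating_over :: "('a \<Rightarrow> 'a \<Rightarrow> int) \<Rightarrow> 'a \<Rightarrow> 'a list \<Rightarrow> bool" where
  "alternating_over s z xs \<longleftrightarrow>
    (\<forall>j < length xs. \<forall>i < j. s (xs ! i) (xs ! j) = (-1) ^ (i + j) * s z (xs ! i) * s z (xs ! j))"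

lemma alternating_over_5:
  "alternating_over s z [a, b, c, d, e] \<longleftrightarrow>
    s a b = - s z a * s z b \<and> s a c = s z a * s z c \<and> s a d = - s z a * s z d \<and>
    s a e = s z a * s z e \<and> s b c = - s z b * s z c \<and> s b d = s z b * s z d \<and>
    s b e = - s z b * s z e \<and> s c d = - s z c * s z d \<and> s c e = s z c * s z e \<and>
    s d e = - s z d * s z e"
  by (simp add: alternating_over_def All_less_Suc numeral_eq_Suc conj_ac)

text \<open>Both sides of each defining equation acquire the factor
  \<open>\<epsilon> u * \<epsilon> v\<close>; on the right the sign of \<open>z\<close> occurs twice
  and cancels.\<close>

lemma alternating_over_switch:
  fixes \<epsilon> :: "'a \<Rightarrow> int"
  assumes "\<And>u. (\<epsilon> u)\<^sup>2 = 1"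
  shows "alternating_over (\<lambda>u v. \<epsilon> u * \<epsilon> v * s u v) z xs \<longleftrightarrow> alternating_over s z xs"
proof -
  have nz: "\<epsilon> u \<noteq> 0" and sq: "\<epsilon> u * \<epsilon> u = 1" for u
    using assms[of u] by (auto simp: power2_eq_square)
  have "\<epsilon> u * \<epsilon> v * s u v = p * (\<epsilon> z * \<epsilon> u * s z u) * (\<epsilon> z * \<epsilon> v * s z v) \<longleftrightarrow>
      s u v = p * s z u * s z v" for u v p
  proof -
    have "p * (\<epsilon> z * \<epsilon> u * s z u) * (\<epsilon> z * \<epsilon> v * s z v) =
        (\<epsilon> z * \<epsilon> z) * (\<epsilon> u * \<epsilon> v * (p * s z u * s z v))"
      by (simp only: ac_simps)
    then have eq: "p * (\<epsilon> z * \<epsilon> u * s z u) * (\<epsilon> z * \<epsilon> v * s z v) =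
        \<epsilon> u * \<epsilon> v * (p * s z u * s z v)"
      by (simp only: sq mult_1_left)
    show ?thesis
      unfolding eq using nz[of u] nz[of v] by simp
  qed
  then show ?thesis by (simp add: alternating_over_def)
qed

text \<open>Put \<open>\<eta> i = (-1) ^ i * s z (xs ! i)\<close>. Then
  \<open>s (xs ! i) (xs ! j) = \<eta> i * \<eta> j\<close> for \<open>i < j\<close>, so each
  4-vertex Pfaffian inside \<open>xs\<close> is the product of its four signs. The five terms of the
  expansion along \<open>z\<close> therefore all equal the product of all \<open>\<eta> i\<close>,
  and the Pfaffian is 5 or -5.\<close>

lemma pf6_alternating_over:
  assumes "alternating_over s z [a, b, c, d, e]"
    "s z a = 1 \<or> s z a = -1" "s z b = 1 \<or> s z b = -1" "s z c = 1 \<or> s z c = -1"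
    "s z d = 1 \<or> s z d = -1" "s z e = 1 \<or> s z e = -1"
  shows "(pf6 s z a b c d e)\<^sup>2 = 25"
  using assms unfolding alternating_over_5 by (elim disjE) (simp_all add: pf6_def pf4_def)

text \<open>The finite core, for the normal form in which \<open>z\<close> dominates a Hamiltonian
  path. Only the signs of \<open>ac\<close>, \<open>ad\<close>, \<open>ae\<close>,
  \<open>bd\<close>, \<open>be\<close> and \<open>ce\<close> are free, and all their values are
  checked. The multiset equation in the second claim says that \<open>y # xs\<close> rearranges the
  six vertices.\<close>

lemma dominated_path_6:
  fixes t :: "'a \<Rightarrow> 'a \<Rightarrow> int"
  assumes t: "skew_sign_on {z, a, b, c, d, e} t" and "distinct [z, a, b, c, d, e]"
    and z: "t z a = 1" "t z b = 1" "t z c = 1" "t z d = 1" "t z e = 1"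
    and path: "t a b = 1" "t b c = 1" "t c d = 1" "t d e = 1"
  shows "(pf6 t z a b c d e)\<^sup>2 = 25 \<longleftrightarrow> diamond_count t [z, a, b, c, d, e] = 5"
    and "(pf6 t z a b c d e)\<^sup>2 = 25 \<Longrightarrow>
      \<exists>y xs. mset (y # xs) = mset [z, a, b, c, d, e] \<and> alternating_over t y xs"
proof -
  have cases: "t a c = 1 \<or> t a c = -1" "t a d = 1 \<or> t a d = -1" "t a e = 1 \<or> t a e = -1"
    "t b d = 1 \<or> t b d = -1" "t b e = 1 \<or> t b e = -1" "t c e = 1 \<or> t c e = -1"
    using assms(2) by - (rule skew_sign_on_cases[OF t]; simp)+
  have swap: "t a z = - t z a" "t b z = - t z b" "t c z = - t z c" "t d z = - t z d" "t e z = - t z e"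
    "t b a = - t a b" "t c a = - t a c" "t d a = - t a d" "t e a = - t a e" "t c b = - t b c"
    "t d b = - t b d" "t e b = - t b e" "t d c = - t c d" "t e c = - t c e" "t e d = - t d e"
    by (rule skew_sign_on_swap[OF t]; simp)+
  \<comment> \<open>One orientation of the six remaining arcs for each of the twelve orderings; in the other
    52 cases the determinant is not 25.\<close>
  have *: "((pf6 t z a b c d e)\<^sup>2 = 25 \<longleftrightarrow> diamond_count t [z, a, b, c, d, e] = 5) \<and>
    ((pf6 t z a b c d e)\<^sup>2 = 25 \<longrightarrow>
      alternating_over t e [z, a, b, c, d] \<or> alternating_over t d [b, c, z, e, a] \<or> alternating_over t d [z, a, b, e, c] \<or>
      alternating_over t c [b, z, d, a, e] \<or> alternating_over t z [c, a, d, b, e] \<or> alternating_over t c [z, a, b, d, e] \<or>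
      alternating_over t b [c, a, d, e, z] \<or> alternating_over t a [b, c, d, e, z] \<or> alternating_over t z [e, d, c, b, a] \<or>
      alternating_over t z [d, b, a, c, e] \<or> alternating_over t b [e, a, z, c, d] \<or> alternating_over t c [a, b, z, d, e])"
    using cases unfolding alternating_over_5
    by (elim disjE) (simp_all add: pf6_def pf4_def diamond_count_def swap z path)
  then show "(pf6 t z a b c d e)\<^sup>2 = 25 \<longleftrightarrow> diamond_count t [z, a, b, c, d, e] = 5"
    by (rule conjunct1)
  have ex: "\<exists>y xs. mset (y # xs) = mset [z, a, b, c, d, e] \<and> alternating_over t y xs"
    if "alternating_over t y xs" "mset (y # xs) = mset [z, a, b, c, d, e]" for y xs
    using that by blast
  assume "(pf6 t z a b c d e)\<^sup>2 = 25"
  from *[THEN conjunct2, THEN mp, OF this]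
  show "\<exists>y xs. mset (y # xs) = mset [z, a, b, c, d, e] \<and> alternating_over t y xs"
    by (elim disjE) (erule ex, simp)+
qed

text \<open>Switching by the signs \<open>s z u\<close> makes \<open>z\<close> dominate every other
  vertex, and Redei's theorem orders the rest of the switched tournament.\<close>

lemma ex_dominated_path:
  assumes s: "skew_sign_on V s" and "finite V" and "z \<in> V"
  shows "\<exists>\<epsilon> vs. (\<forall>u. \<epsilon> u = 1 \<or> \<epsilon> u = (-1 :: int)) \<and> distinct (z # vs) \<and> set (z # vs) = V \<and>
    (\<forall>u \<in> set vs. \<epsilon> z * \<epsilon> u * s z u = 1) \<and> successively (\<lambda>u v. \<epsilon> u * \<epsilon> v * s u v = 1) vs"
proof -
  \<comment> \<open>The value 1 at \<open>z\<close>, where \<open>s z z = 0\<close>, and outside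
    \<open>V\<close> keeps \<open>\<epsilon>\<close> equal to 1 or -1 everywhere.\<close>
  define \<epsilon> where "\<epsilon> u = (if u \<in> V - {z} then s z u else 1)" for u
  have \<epsilon>: "\<epsilon> u = 1 \<or> \<epsilon> u = -1" for u
    using skew_sign_on_cases[OF s \<open>z \<in> V\<close>, of u] by (auto simp: \<epsilon>_def)
  let ?t = "\<lambda>u v. \<epsilon> u * \<epsilon> v * s u v"
  have t: "skew_sign_on V ?t"
    using s \<epsilon> by (intro skew_sign_on_switch) auto
  have "?t u v = 1 \<or> ?t v u = 1" if "u \<in> V - {z}" "v \<in> V - {z}" "u \<noteq> v" for u v
    using skew_sign_on_cases[OF t, of u v] skew_sign_on_swap[OF t, of u v] that by auto
  then obtain vs where vs: "distinct vs" "set vs = V - {z}" "successively (\<lambda>u v. ?t u v = 1) vs"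
    using ex_Hamiltonian_list[of "V - {z}" "\<lambda>u v. ?t u v = 1"] \<open>finite V\<close> by auto
  have "?t z u = 1" if "u \<in> set vs" for u
  proof -
    have "u \<in> V" "z \<noteq> u"
      using that by (auto simp: vs(2))
    then show ?thesis
      using skew_sign_on_cases[OF s \<open>z \<in> V\<close>, of u] by (auto simp: \<epsilon>_def)
  qed
  with \<epsilon> vs \<open>z \<in> V\<close> show ?thesis
    by (intro exI[of _ \<epsilon>] exI[of _ vs]) auto
qed

text \<open>The squared Pfaffian, the diamond count and alternation are all unchanged by switching,
  so what holds for the normal form \<open>t\<close> carries back to
  \<open>arc_sign G\<close>.\<close>

lemma (in tournament) det_eq_25_characterizations:
  assumes "card (verts G) = 6"
  shows "tournament_det G = 25 \<longleftrightarrow> \<delta> G = 5"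
    and "tournament_det G = 25 \<longleftrightarrow> (\<exists>z xs. distinct (z # xs) \<and> set (z # xs) = verts G \<and>
      alternating_over (arc_sign G) z xs)"
proof -
  define s where "s = arc_sign G"
  have s: "skew_sign_on (verts G) s"
    using skew_sign_on_arc_sign by (simp add: s_def)
  have "verts G \<noteq> {}" using assms by auto
  then obtain z where "z \<in> verts G" by blast
  obtain \<epsilon> vs where \<epsilon>: "\<And>u. \<epsilon> u = 1 \<or> \<epsilon> u = (-1 :: int)"
    and vs: "distinct (z # vs)" "set (z # vs) = verts G"
    and z: "\<And>u. u \<in> set vs \<Longrightarrow> \<epsilon> z * \<epsilon> u * s z u = 1"
    and path: "successively (\<lambda>u v. \<epsilon> u * \<epsilon> v * s u v = 1) vs"
    using ex_dominated_path[OF s finite_verts \<open>z \<in> verts G\<close>] by blast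
  have "length (z # vs) = 6"
    using distinct_card[OF vs(1)] vs(2) assms by simp
  then obtain a b c d e where vs_eq: "vs = [a, b, c, d, e]"
    by (auto simp: numeral_eq_Suc length_Suc_conv)
  have \<epsilon>2: "(\<epsilon> u)\<^sup>2 = 1" for u
    using \<epsilon>[of u] by auto
  define t where "t = (\<lambda>u v. \<epsilon> u * \<epsilon> v * s u v)"
  have t: "skew_sign_on {z, a, b, c, d, e} t"
    using skew_sign_on_switch[OF s, of \<epsilon>] \<epsilon> vs(2) by (simp add: vs_eq t_def)
  have tz: "t z a = 1" "t z b = 1" "t z c = 1" "t z d = 1" "t z e = 1"
    using z by (simp_all add: vs_eq t_def)
  have tpath: "t a b = 1" "t b c = 1" "t c d = 1" "t d e = 1"
    using path by (simp_all add: vs_eq t_def)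
  have dist: "distinct [z, a, b, c, d, e]" and verts: "verts G = {z, a, b, c, d, e}"
    using vs by (auto simp: vs_eq)
  have det: "tournament_det G = (pf6 t z a b c d e)\<^sup>2"
    using tournament_det_6[OF dist verts]
    by (simp add: t_def pf6_switch[of \<epsilon>] power_mult_distrib \<epsilon>2 s_def)
  have "\<delta> G = diamond_count t [z, a, b, c, d, e]"
    using num_diamonds_eq_diamond_count[OF dist] verts diamond_count_switch[of \<epsilon> s, OF \<epsilon>2]
    by (simp add: t_def s_def)
  then show "tournament_det G = 25 \<longleftrightarrow> \<delta> G = 5"
    using dominated_path_6(1)[OF t dist tz tpath] det by simp
  show "tournament_det G = 25 \<longleftrightarrow> (\<exists>z xs. distinct (z # xs) \<and> set (z # xs) = verts G \<and>
      alternating_over (arc_sign G) z xs)"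
  proof
    assume "tournament_det G = 25"
    then obtain y xs where y: "mset (y # xs) = mset [z, a, b, c, d, e]" "alternating_over t y xs"
      using dominated_path_6(2)[OF t dist tz tpath] det by auto
    have "distinct (y # xs)" "set (y # xs) = verts G"
      using mset_eq_imp_distinct_iff[OF y(1)] mset_eq_setD[OF y(1)] dist verts by auto
    moreover have "alternating_over (arc_sign G) y xs"
      using y(2) alternating_over_switch[of \<epsilon> s, OF \<epsilon>2] by (simp add: t_def s_def)
    ultimately show "\<exists>z xs. distinct (z # xs) \<and> set (z # xs) = verts G \<and>
        alternating_over (arc_sign G) z xs"
      by blast
  next
    assume "\<exists>z xs. distinct (z # xs) \<and> set (z # xs) = verts G \<and> alternating_over (arc_sign G) z xs"
    then obtain y xs where y: "distinct (y # xs)" "set (y # xs) = verts G" "alternating_over s y xs"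
      unfolding s_def by blast
    have "length (y # xs) = 6"
      using distinct_card[OF y(1)] y(2) assms by simp
    then obtain a b c d e where xs: "xs = [a, b, c, d, e]"
      by (auto simp: numeral_eq_Suc length_Suc_conv)
    have "s y u = 1 \<or> s y u = -1" if "u \<in> set xs" for u
      using that y(1,2) by (intro skew_sign_on_cases[OF s]) auto
    then have "(pf6 s y a b c d e)\<^sup>2 = 25"
      using y(3) by (intro pf6_alternating_over) (auto simp: xs)
    then show "tournament_det G = 25"
      using tournament_det_6[of y a b c d e] y(1,2) by (simp add: xs s_def)
  qed
qed

section \<open>Recognising \<open>L\<^sub>6\<close> up to isomorphism and switching\<close>

lemma dominates_L\<^sub>6:
  "u \<rightarrow>\<^bsub>L\<^sub>6\<^esub> v \<longleftrightarrow> 1 \<le> u \<and> u < v \<and> v \<le> 5 \<or>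
    u = 6 \<and> (v = 1 \<or> v = 3 \<or> v = 5) \<or> v = 6 \<and> (u = 2 \<or> u = 4)"
  unfolding arcs_ends_conv L\<^sub>6_def by auto

text \<open>The vertices \<open>a\<close>, ..., \<open>e\<close> play the roles of 1, ..., 5 and
  \<open>z\<close> that of 6. The fifteen sign equations fix every arc, in a form that can be
  compared with \<open>alternating_over_5\<close>.\<close>

lemma digraph_iso_L\<^sub>6_iff:
  assumes "tournament H"
  shows "digraph_iso H L\<^sub>6 \<longleftrightarrow> (\<exists>z a b c d e. distinct [z, a, b, c, d, e] \<and> verts H = {z, a, b, c, d, e} \<and>
    arc_sign H a b = 1 \<and> arc_sign H a c = 1 \<and> arc_sign H a d = 1 \<and> arc_sign H a e = 1 \<and>
    arc_sign H b c = 1 \<and> arc_sign H b d = 1 \<and> arc_sign H b e = 1 \<and>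
    arc_sign H c d = 1 \<and> arc_sign H c e = 1 \<and> arc_sign H d e = 1 \<and>
    arc_sign H z a = 1 \<and> arc_sign H z b = -1 \<and> arc_sign H z c = 1 \<and>
    arc_sign H z d = -1 \<and> arc_sign H z e = 1)" (is "_ = ?R")
proof -
  interpret H: tournament H by (rule assms)
  interpret L: tournament L\<^sub>6 by (rule tournament_L\<^sub>6)
  have verts_L: "verts L\<^sub>6 = {1, 2, 3, 4, 5, 6}"
    by (auto simp: L\<^sub>6_def)
  note iso_iff = digraph_iso_iff_dominates_bij[OF H.nomulti_digraph L.nomulti_digraph]
  show ?thesis
  proof
    assume "digraph_iso H L\<^sub>6"
    then obtain h where h: "bij_betw h (verts H) (verts L\<^sub>6)"
      and dom: "\<And>u v. u \<in> verts H \<Longrightarrow> v \<in> verts H \<Longrightarrow> u \<rightarrow>\<^bsub>H\<^esub> v \<longleftrightarrow> h u \<rightarrow>\<^bsub>L\<^sub>6\<^esub> h v"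
      unfolding iso_iff by blast
    \<comment> \<open>The inverse of the isomorphism names the vertices of \<open>H\<close> by 1 to
      6.\<close>
    define g where "g = the_inv_into (verts H) h"
    have g: "bij_betw g (verts L\<^sub>6) (verts H)"
      unfolding g_def by (rule bij_betw_the_inv_into[OF h])
    have hg: "h (g i) = i" and gV: "g i \<in> verts H" if "i \<in> verts L\<^sub>6" for i
      using that h g unfolding g_def bij_betw_def by (auto simp: f_the_inv_into_f)
    have sign: "arc_sign H (g i) (g j) = arc_sign L\<^sub>6 i j" if "i \<in> verts L\<^sub>6" "j \<in> verts L\<^sub>6" for i j
      using that by (simp add: arc_sign_def dom gV hg)
    have "distinct (map g [6, 1, 2, 3, 4, 5])"
      using g unfolding distinct_map bij_betw_def by (simp add: verts_L insert_commute)
    then have dist: "distinct [g 6, g 1, g 2, g 3, g 4, g 5]"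
      by (simp only: list.map)
    have V: "verts H = {g 6, g 1, g 2, g 3, g 4, g 5}"
      using g unfolding bij_betw_def verts_L by auto
    have S: "arc_sign H (g 1) (g 2) = 1" "arc_sign H (g 1) (g 3) = 1" "arc_sign H (g 1) (g 4) = 1"
      "arc_sign H (g 1) (g 5) = 1" "arc_sign H (g 2) (g 3) = 1" "arc_sign H (g 2) (g 4) = 1"
      "arc_sign H (g 2) (g 5) = 1" "arc_sign H (g 3) (g 4) = 1" "arc_sign H (g 3) (g 5) = 1"
      "arc_sign H (g 4) (g 5) = 1" "arc_sign H (g 6) (g 1) = 1" "arc_sign H (g 6) (g 2) = -1"
      "arc_sign H (g 6) (g 3) = 1" "arc_sign H (g 6) (g 4) = -1" "arc_sign H (g 6) (g 5) = 1"
      by (subst sign; simp add: verts_L arc_sign_def dominates_L\<^sub>6)+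
    show ?R
      by (intro exI conjI) (rule dist V S)+
  next
    assume ?R
    then obtain z a b c d e where dist: "distinct [z, a, b, c, d, e]" and V: "verts H = {z, a, b, c, d, e}"
      and s: "arc_sign H a b = 1" "arc_sign H a c = 1" "arc_sign H a d = 1" "arc_sign H a e = 1"
        "arc_sign H b c = 1" "arc_sign H b d = 1" "arc_sign H b e = 1"
        "arc_sign H c d = 1" "arc_sign H c e = 1" "arc_sign H d e = 1"
        "arc_sign H z a = 1" "arc_sign H z b = -1" "arc_sign H z c = 1"
        "arc_sign H z d = -1" "arc_sign H z e = 1"
      by (elim exE conjE) (rule that)
    have sw: "arc_sign H v u = - arc_sign H u v" if "u \<in> verts H" "v \<in> verts H" for u v
      using that by (rule skew_sign_on_swap[OF H.skew_sign_on_arc_sign])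
    have swap: "arc_sign H b a = -1" "arc_sign H c a = -1" "arc_sign H d a = -1" "arc_sign H e a = -1"
        "arc_sign H c b = -1" "arc_sign H d b = -1" "arc_sign H e b = -1"
        "arc_sign H d c = -1" "arc_sign H e c = -1" "arc_sign H e d = -1"
        "arc_sign H a z = -1" "arc_sign H b z = 1" "arc_sign H c z = -1"
        "arc_sign H d z = 1" "arc_sign H e z = -1"
      using s sw[of a b] sw[of a c] sw[of a d] sw[of a e] sw[of b c] sw[of b d] sw[of b e]
        sw[of c d] sw[of c e] sw[of d e] sw[of z a] sw[of z b] sw[of z c] sw[of z d] sw[of z e]
      by (simp_all add: V)
    have diag: "arc_sign H u u = 0" if "u \<in> verts H" for u
      using that by (rule skew_sign_on_diag[OF H.skew_sign_on_arc_sign])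
    have dom: "u \<rightarrow>\<^bsub>H\<^esub> v \<longleftrightarrow> arc_sign H u v = 1" for u v
      by (simp add: arc_sign_def)
    \<comment> \<open>The final default value 6 is the one meant for \<open>z\<close>.\<close>
    define h :: "'a \<Rightarrow> nat" where "h u = (if u = a then 1 else if u = b then 2 else if u = c then 3
      else if u = d then 4 else if u = e then 5 else 6)" for u
    have h: "h a = 1" "h b = 2" "h c = 3" "h d = 4" "h e = 5" "h z = 6"
      using dist by (auto simp: h_def)
    have "bij_betw h (verts H) (verts L\<^sub>6)"
      unfolding bij_betw_def V verts_L by (auto simp: inj_on_def h)
    moreover have "\<forall>u \<in> verts H. \<forall>v \<in> verts H. u \<rightarrow>\<^bsub>H\<^esub> v \<longleftrightarrow> h u \<rightarrow>\<^bsub>L\<^sub>6\<^esub> h v"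
      unfolding dom dominates_L\<^sub>6 using diag by (simp add: V h s swap)
    ultimately show "digraph_iso H L\<^sub>6"
      unfolding iso_iff by blast
  qed
qed

text \<open>The signs of \<open>L\<^sub>6\<close> satisfy the alternating equations, which survive
  switching. Conversely, those equations make the remaining vertices transitive as soon as the arcs
  at \<open>z\<close> are switched into the pattern of \<open>L\<^sub>6\<close>.\<close>

lemma (in tournament) switching_equivalent_iso_L\<^sub>6_iff:
  "switching_equivalent_iso G L\<^sub>6 \<longleftrightarrow> (\<exists>z a b c d e. distinct [z, a, b, c, d, e] \<and>
    verts G = {z, a, b, c, d, e} \<and> alternating_over (arc_sign G) z [a, b, c, d, e])"
proof
  assume "switching_equivalent_iso G L\<^sub>6"
  then obtain W where "digraph_iso (switch G W) L\<^sub>6"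
    by (auto simp: switching_equivalent_iso_def switching_equivalent_def)
  then obtain z a b c d e where dist: "distinct [z, a, b, c, d, e]" and V: "verts G = {z, a, b, c, d, e}"
    and s: "arc_sign (switch G W) a b = 1" "arc_sign (switch G W) a c = 1" "arc_sign (switch G W) a d = 1"
      "arc_sign (switch G W) a e = 1" "arc_sign (switch G W) b c = 1" "arc_sign (switch G W) b d = 1"
      "arc_sign (switch G W) b e = 1" "arc_sign (switch G W) c d = 1" "arc_sign (switch G W) c e = 1"
      "arc_sign (switch G W) d e = 1" "arc_sign (switch G W) z a = 1" "arc_sign (switch G W) z b = -1"
      "arc_sign (switch G W) z c = 1" "arc_sign (switch G W) z d = -1" "arc_sign (switch G W) z e = 1"
    unfolding digraph_iso_L\<^sub>6_iff[OF tournament_switch] verts_switch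
    by (elim exE conjE) (rule that)
  define \<epsilon> :: "'a \<Rightarrow> int" where "\<epsilon> u = (if u \<in> W then -1 else 1)" for u
  have \<epsilon>2: "(\<epsilon> u)\<^sup>2 = 1" for u
    by (simp add: \<epsilon>_def)
  have "arc_sign (switch G W) u v = \<epsilon> u * \<epsilon> v * arc_sign G u v" if "u \<in> verts G" "v \<in> verts G" for u v
    using arc_sign_switch[OF that] by (simp add: \<epsilon>_def)
  \<comment> \<open>In \<open>L\<^sub>6\<close> the signs from \<open>z\<close> are 1, -1, 1, -1, 1,
    so every right-hand side in \<open>alternating_over_5\<close> becomes 1, as transitivity
    requires.\<close>
  then have "alternating_over (\<lambda>u v. \<epsilon> u * \<epsilon> v * arc_sign G u v) z [a, b, c, d, e]"
    using s unfolding alternating_over_5 by (simp add: V)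
  then have "alternating_over (arc_sign G) z [a, b, c, d, e]"
    unfolding alternating_over_switch[of \<epsilon>, OF \<epsilon>2] .
  with dist V show "\<exists>z a b c d e. distinct [z, a, b, c, d, e] \<and>
      verts G = {z, a, b, c, d, e} \<and> alternating_over (arc_sign G) z [a, b, c, d, e]"
    by blast
next
  assume "\<exists>z a b c d e. distinct [z, a, b, c, d, e] \<and>
    verts G = {z, a, b, c, d, e} \<and> alternating_over (arc_sign G) z [a, b, c, d, e]"
  then obtain z a b c d e where dist: "distinct [z, a, b, c, d, e]" and V: "verts G = {z, a, b, c, d, e}"
    and alt: "alternating_over (arc_sign G) z [a, b, c, d, e]"
    by (elim exE conjE) (rule that)
  \<comment> \<open>\<open>W\<close> collects the vertices whose arc with \<open>z\<close> points
    the wrong way: in \<open>L\<^sub>6\<close> the vertex \<open>z\<close> dominates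
    \<open>a\<close>, \<open>c\<close>, \<open>e\<close> and is dominated by \<open>b\<close>,
    \<open>d\<close>.\<close>
  define W where "W = {u \<in> {a, c, e}. arc_sign G z u = -1} \<union> {u \<in> {b, d}. arc_sign G z u = 1}"
  have z: "arc_sign G z a = 1 \<or> arc_sign G z a = -1" "arc_sign G z b = 1 \<or> arc_sign G z b = -1"
    "arc_sign G z c = 1 \<or> arc_sign G z c = -1" "arc_sign G z d = 1 \<or> arc_sign G z d = -1"
    "arc_sign G z e = 1 \<or> arc_sign G z e = -1"
    using dist by - (rule skew_sign_on_cases[OF skew_sign_on_arc_sign]; simp add: V)+
  have W: "z \<notin> W" "a \<in> W \<longleftrightarrow> arc_sign G z a = -1" "b \<in> W \<longleftrightarrow> arc_sign G z b = 1"
    "c \<in> W \<longleftrightarrow> arc_sign G z c = -1" "d \<in> W \<longleftrightarrow> arc_sign G z d = 1" "e \<in> W \<longleftrightarrow> arc_sign G z e = -1"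
    using dist by (auto simp: W_def)
  define \<epsilon> :: "'a \<Rightarrow> int" where "\<epsilon> u = (if u \<in> W then -1 else 1)" for u
  have \<epsilon>: "\<epsilon> z = 1" "\<epsilon> a = arc_sign G z a" "\<epsilon> b = - arc_sign G z b" "\<epsilon> c = arc_sign G z c"
    "\<epsilon> d = - arc_sign G z d" "\<epsilon> e = arc_sign G z e"
    using z by (auto simp: \<epsilon>_def W)
  \<comment> \<open>The second equation cancels a square inside the right-nested products that
    \<open>ac_simps\<close> produces.\<close>
  have sq: "arc_sign G z u * arc_sign G z u = 1" "arc_sign G z u * (arc_sign G z u * x) = x"
    if "u \<in> {a, b, c, d, e}" for u x
    using that z by auto
  have sign: "arc_sign (switch G W) u v = \<epsilon> u * \<epsilon> v * arc_sign G u v"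
    if "u \<in> {z, a, b, c, d, e}" "v \<in> {z, a, b, c, d, e}" for u v
    using arc_sign_switch[of u v W] that by (simp add: V \<epsilon>_def)
  have S: "arc_sign (switch G W) a b = 1" "arc_sign (switch G W) a c = 1" "arc_sign (switch G W) a d = 1"
    "arc_sign (switch G W) a e = 1" "arc_sign (switch G W) b c = 1" "arc_sign (switch G W) b d = 1"
    "arc_sign (switch G W) b e = 1" "arc_sign (switch G W) c d = 1" "arc_sign (switch G W) c e = 1"
    "arc_sign (switch G W) d e = 1" "arc_sign (switch G W) z a = 1" "arc_sign (switch G W) z b = -1"
    "arc_sign (switch G W) z c = 1" "arc_sign (switch G W) z d = -1" "arc_sign (switch G W) z e = 1"
    using alt[unfolded alternating_over_5] by (simp_all add: sign \<epsilon> sq ac_simps)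
  have "digraph_iso (switch G W) L\<^sub>6"
    unfolding digraph_iso_L\<^sub>6_iff[OF tournament_switch] verts_switch
    by (intro exI conjI) (rule dist V S)+
  moreover have "W \<subseteq> verts G"
    by (auto simp: W_def V)
  ultimately show "switching_equivalent_iso G L\<^sub>6"
    by (auto simp: switching_equivalent_iso_def switching_equivalent_def)
qed

section \<open>Determinant bounds and membership in \<open>\<D> 5 - \<D> 3\<close>\<close>

context tournament
begin

text \<open>Odd orders give 0 and order 2 gives 1. In order 4 the Pfaffian is a sum of three terms
  equal to 1 or -1, so its square is at most 9.\<close>

lemma tournament_det_induce_subgraph_le_9:
  assumes "W \<subseteq> verts G" "W \<noteq> {}" "card W < 6"
  shows "tournament_det (G \<restriction> W) \<le> 9"
proof -
  have "finite W" using assms(1) finite_verts by (rule finite_subset)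
  then obtain vs where vs: "distinct vs" "set vs = W"
    using finite_distinct_list by blast
  have len: "length vs < 6" "length vs \<noteq> 0"
    using assms vs distinct_card[OF vs(1)] by auto
  from len have "length vs = 1 \<or> length vs = 2 \<or> length vs = 3 \<or> length vs = 4 \<or> length vs = 5"
    by arith
  then consider "odd (length vs)" | "length vs = 2" | "length vs = 4"
    by (elim disjE) simp_all
  then show ?thesis
  proof cases
    case 1
    then show ?thesis
      using tournament_det_induce_subgraph_odd vs assms(1) by auto
  next
    case 2
    then obtain a b where "vs = [a, b]"
      by (auto simp: numeral_eq_Suc length_Suc_conv)
    then show ?thesis
      using tournament_det_induce_subgraph_2[of a b] vs assms(1) by auto
  next
    case 3
    then obtain a b c d where eq: "vs = [a, b, c, d]"
      by (auto simp: numeral_eq_Suc length_Suc_conv)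
    define s where "s = arc_sign G"
    have "s a b = 1 \<or> s a b = -1" "s a c = 1 \<or> s a c = -1" "s a d = 1 \<or> s a d = -1"
      "s b c = 1 \<or> s b c = -1" "s b d = 1 \<or> s b d = -1" "s c d = 1 \<or> s c d = -1"
      unfolding s_def using vs assms(1)
      by - (rule skew_sign_on_cases[OF skew_sign_on_arc_sign]; auto simp: eq)+
    then have "(pf4 s a b c d)\<^sup>2 \<le> 9"
      by (elim disjE) (simp_all add: pf4_def)
    then show ?thesis
      using tournament_det_induce_subgraph_4[of a b c d] vs assms(1) by (auto simp: eq s_def)
  qed
qed

lemma in_\<D>_5_diff_\<D>_3_iff:
  assumes "card (verts G) = 6"
  shows "G \<in> \<D> 5 - \<D> 3 \<longleftrightarrow> tournament_det G = 25"
proof -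
  obtain vs where vs: "distinct vs" "set vs = verts G"
    using finite_distinct_list finite_verts by blast
  then have "length vs = 6"
    using assms distinct_card by fastforce
  then obtain a b c d e f where eq: "vs = [a, b, c, d, e, f]"
    by (auto simp: numeral_eq_Suc length_Suc_conv)
  define p where "p = pf6 (arc_sign G) a b c d e f"
  have det: "tournament_det G = p\<^sup>2"
    unfolding p_def using vs by (intro tournament_det_6) (auto simp: eq)
  \<comment> \<open>The Pfaffian expands into fifteen products of three odd signs, an odd number of
    odd terms.\<close>
  have "odd (arc_sign G u v)" if "u \<in> verts G" "v \<in> verts G" "u \<noteq> v" for u v
    using skew_sign_on_cases[OF skew_sign_on_arc_sign that] by auto
  then have "odd p"
    using vs by (simp add: p_def pf6_def pf4_def eq flip: vs(2))
  have sub: "tournament_det (G \<restriction> W) \<le> 9" if "W \<subseteq> verts G" "W \<noteq> {}" "W \<noteq> verts G" for W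
    using that assms psubset_card_mono[OF finite_verts, of W]
    by (intro tournament_det_induce_subgraph_le_9) auto
  \<comment> \<open>For \<open>k \<ge> 3\<close> the bound is at least 9, which every proper
    subtournament meets, so only the determinant of \<open>G\<close> itself decides
    membership.\<close>
  have mem: "G \<in> \<D> k \<longleftrightarrow> tournament_det G \<le> (int k)\<^sup>2" if "k \<ge> 3" for k
  proof -
    have "(9 :: int) \<le> (int k)\<^sup>2"
      using power_mono[of 3 "int k" 2] that by simp
    moreover have "verts G \<noteq> {}" using assms by auto
    moreover have "tournament G" by unfold_locales
    ultimately show ?thesis
      unfolding det_bounded_tournaments_def mem_Collect_eq
      using sub induce_subgraph_verts_self by (metis order_refl order_trans)
  qed
  have "p\<^sup>2 = 25" if "\<not> p\<^sup>2 \<le> 9" "p\<^sup>2 \<le> 25"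
  proof -
    have "\<bar>p\<bar> \<le> 5" "\<not> \<bar>p\<bar> \<le> 3"
      using that abs_le_square_iff[of p 5] abs_le_square_iff[of p 3] by auto
    \<comment> \<open>Parity then excludes the absolute value 4.\<close>
    then have "p = 5 \<or> p = 4 \<or> p = -4 \<or> p = -5" by arith
    then show ?thesis using \<open>odd p\<close> by auto
  qed
  then show ?thesis
    using mem[of 5] mem[of 3] det by auto
qed

end

section \<open>Equivalence of the four conditions\<close>

theorem theorem2p11:
  fixes T :: "('a, 'b) pre_digraph"
  assumes "tournament T" and "card (verts T) = 6"
  shows "(tournament_det T = 25 \<longleftrightarrow> \<delta> T = 5)
    \<and> (\<delta> T = 5 \<longleftrightarrow> switching_equivalent_iso T L\<^sub>6)
    \<and> (switching_equivalent_iso T L\<^sub>6 \<longleftrightarrow> T \<in> \<D> 5 - \<D> 3)"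
proof -
  interpret tournament T by (rule assms(1))
  \<comment> \<open>The two characterisations by alternation differ only in form: a list
    \<open>xs\<close> of unspecified length, forced to be 5 by the six vertices, against five named
    entries.\<close>
  have "(\<exists>z xs. distinct (z # xs) \<and> set (z # xs) = verts T \<and> alternating_over (arc_sign T) z xs) \<longleftrightarrow>
      switching_equivalent_iso T L\<^sub>6" (is "?A \<longleftrightarrow> _")
  proof
    assume ?A
    then obtain z xs where xs: "distinct (z # xs)" "set (z # xs) = verts T"
      "alternating_over (arc_sign T) z xs"
      by blast
    then have "length (z # xs) = 6"
      using assms(2) distinct_card by fastforce
    then obtain a b c d e where "xs = [a, b, c, d, e]"
      by (auto simp: numeral_eq_Suc length_Suc_conv)
    then show "switching_equivalent_iso T L\<^sub>6"
      unfolding switching_equivalent_iso_L\<^sub>6_iff using xs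
      by (intro exI[of _ z] exI[of _ a] exI[of _ b] exI[of _ c] exI[of _ d] exI[of _ e]) simp
  next
    assume "switching_equivalent_iso T L\<^sub>6"
    then obtain z a b c d e where "distinct [z, a, b, c, d, e]" "verts T = {z, a, b, c, d, e}"
      "alternating_over (arc_sign T) z [a, b, c, d, e]"
      unfolding switching_equivalent_iso_L\<^sub>6_iff by (elim exE conjE) (rule that)
    then show ?A
      by (intro exI[of _ z] exI[of _ "[a, b, c, d, e]"]) simp
  qed
  then show ?thesis
    using det_eq_25_characterizations[OF assms(2)] in_\<D>_5_diff_\<D>_3_iff[OF assms(2)] by simp
qed

end
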